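(* Let $P\subset\mathbb{R}^2$ be the lattice triangle with vertices $(0,0),(1,0),(0,1)$, let $X=\mathbb{P}^2$ over $\mathbb{F}_q$ be the toric surface whose complete fan has rays generated by $v(\rho_1)=(1,0)$, $v(\rho_2)=(0,1)$, $v(\rho_3)=(-1,-1)$, and let $D=V(\rho_3)$, so that $P_D=P$ and $\#(P_D\cap\mathbb{Z}^2)=3$. Let $E$ be the formal sum of all points of $T=(\mathbb{F}_q^\ast)^2$ and let $\mathcal{C}_P$ be the associated toric code over $\mathbb{F}_q$, of length $n=(q-1)^2$ and minimum distance $d$. Then $\psi_D$ is strictly convex, and for every prime power $q\ge 8$ one has $\deg(E)=(q-1)^2>1=\deg(D^2)$, while $d=(q-1)^2-(q-1)$, so that $$d< n-2!\cdot\#(P_D\cap\mathbb{Z}^2)=(q-1)^2-6 .$$ In particular, Joyner's conjecture (stated in the context) that $d\ge n-r!\,\#(P_D\cap M)$ for $q$ sufficiently large is false.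
   Context: For a torus-invariant divisor $D=\sum_\rho d_\rho V(\rho)$ on a complete toric variety of dimension $r$ with primitive ray generators $v(\rho)\in\mathbb{Z}^r$, $P_D=\{u\in\mathbb{R}^r\mid\langle u,v(\rho)\rangle\ge-d_\rho\ \text{for all }\rho\}$, and with $M=\mathbb{Z}^r$, $\mathrm{H}^0(X,\mathcal{O}(D))$ is the $\mathbb{F}_q$-vector space of Laurent polynomials in $t_1,\ldots,t_r$ with basis the monomials $\chi^u=t_1^{u_1}\cdots t_r^{u_r}$, $u\in P_D\cap M$. The toric code $\mathcal{C}_P$, with $P=P_D$, is the image of $f\mapsto(f(t))_{t\in T}$, $f\in\mathrm{H}^0(X,\mathcal{O}(D))$, where $T=(\mathbb{F}_q^\ast)^r$; its minimum distance is the least number of nonzero coordinates of a nonzero codeword. The function $\psi_D$ is $\psi_D(v)=\min_{u\in P_D\cap M}\langle u,v\rangle$ for $v\in\mathbb{R}^r$. It is called strictly convex (in the convention of Fulton's book on toric varieties) if $\psi_D(sv+(1-s)w)\ge s\psi_D(v)+(1-s)\psi_D(w)$ for all $v,w$ and $0\le s\le1$, $\psi_D$ is linear on each maximal cone of the fan, and the linear functions so obtained on distinct maximal cones are distinct. $\deg(D^r)$ is the $r$-fold self-intersection number of $D$. Joyner's conjecture: let $X$ be a non-singular toric variety of dimension $r$, $D$ a torus-invariant Cartier divisor with $\psi_D$ strictly convex, and $E$ the formal sum of the evaluation points, with $\deg(E)>\deg(D^r)$. If $q$ is sufficiently large, then any $f\in\mathrm{H}^0(X,\mathcal{O}(D))$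 has no more than $n$ zeros in the rational points of $X$, and consequently the code with length $n$, dimension $k$ and minimum distance $d$ satisfies $k\ge\dim\mathrm{H}^0(X,\mathcal{O}(D))=\#(P_D\cap M)$ and $d\ge n-r!\,\#(P_D\cap M)$. *)

theory Defs
  imports
    "Jordan_Normal_Form.Matrix"
    "HOL-Algebra.Ring"
    "HOL-Library.Multiset"
begin

text \<open>
  The dimension \<open>r\<close> is a parameter, so lattice points and real vectors are vectors in
  \<open>carrier_vec r\<close>. The lattices \<open>M\<close> and \<open>N\<close> are both
  \<open>\<int>\<^sup>r\<close>, paired by the scalar product.
\<close>

abbreviation real_of_int_vec :: "int vec \<Rightarrow> real vec" where
  "real_of_int_vec \<equiv> map_vec real_of_int"


section \<open>Cones and fans\<close>

text \<open>Meaningful for finite \<open>S\<close> only.\<close>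

definition pos_hull :: "nat \<Rightarrow> int vec set \<Rightarrow> real vec set" where
  "pos_hull r S =
    {vec r (\<lambda>i. \<Sum>s\<in>S. c s * real_of_int (s $ i)) | c. \<forall>s\<in>S. 0 \<le> c s}"

definition lattice_polytope :: "nat \<Rightarrow> int vec set \<Rightarrow> real vec set" where
  "lattice_polytope r S =
    {vec r (\<lambda>i. \<Sum>s\<in>S. c s * real_of_int (s $ i)) | c.
       (\<forall>s\<in>S. 0 \<le> c s) \<and> (\<Sum>s\<in>S. c s) = 1}"

definition rational_polyhedral_cone :: "nat \<Rightarrow> real vec set \<Rightarrow> bool" where
  "rational_polyhedral_cone r \<sigma> \<longleftrightarrow>
    (\<exists>S. finite S \<and> S \<subseteq> carrier_vec r \<and> \<sigma> = pos_hull r S)"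

definition strongly_convex_cone :: "nat \<Rightarrow> real vec set \<Rightarrow> bool" where
  "strongly_convex_cone r \<sigma> \<longleftrightarrow> (\<forall>v\<in>\<sigma>. - v \<in> \<sigma> \<longrightarrow> v = 0\<^sub>v r)"

definition face_of_cone :: "nat \<Rightarrow> real vec set \<Rightarrow> real vec set \<Rightarrow> bool" where
  "face_of_cone r \<tau> \<sigma> \<longleftrightarrow>
    (\<exists>u\<in>carrier_vec r. (\<forall>v\<in>\<sigma>. 0 \<le> u \<bullet> v) \<and> \<tau> = {v\<in>\<sigma>. u \<bullet> v = 0})"

definition fan :: "nat \<Rightarrow> real vec set set \<Rightarrow> bool" where
  "fan r \<Delta> \<longleftrightarrow> finite \<Delta> \<and> \<Delta> \<noteq> {} \<and>
    (\<forall>\<sigma>\<in>\<Delta>. rational_polyhedral_cone r \<sigma> \<and> strongly_convex_cone r \<sigma>) \<and>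
    (\<forall>\<sigma>\<in>\<Delta>. \<forall>\<tau>. face_of_cone r \<tau> \<sigma> \<longrightarrow> \<tau> \<in> \<Delta>) \<and>
    (\<forall>\<sigma>\<in>\<Delta>. \<forall>\<tau>\<in>\<Delta>. face_of_cone r (\<sigma> \<inter> \<tau>) \<sigma> \<and> face_of_cone r (\<sigma> \<inter> \<tau>) \<tau>)"

definition complete_fan :: "nat \<Rightarrow> real vec set set \<Rightarrow> bool" where
  "complete_fan r \<Delta> \<longleftrightarrow> fan r \<Delta> \<and> \<Union>\<Delta> = carrier_vec r"

definition lattice_basis :: "nat \<Rightarrow> int vec set \<Rightarrow> bool" where
  "lattice_basis r B \<longleftrightarrow> finite B \<and> B \<subseteq> carrier_vec r \<and>
    (\<forall>v\<in>carrier_vec r. \<exists>!c :: int vec \<Rightarrow> int.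
       (\<forall>b. b \<notin> B \<longrightarrow> c b = 0) \<and> v = vec r (\<lambda>i. \<Sum>b\<in>B. c b * b $ i))"

text \<open>The toric variety of \<open>\<Delta>\<close> is non-singular iff each cone is generated by
  part of a lattice basis.\<close>

definition nonsingular_fan :: "nat \<Rightarrow> real vec set set \<Rightarrow> bool" where
  "nonsingular_fan r \<Delta> \<longleftrightarrow>
    (\<forall>\<sigma>\<in>\<Delta>. \<exists>B S. lattice_basis r B \<and> S \<subseteq> B \<and> \<sigma> = pos_hull r S)"

definition maximal_cones :: "real vec set set \<Rightarrow> real vec set set" where
  "maximal_cones \<Delta> = {\<sigma>\<in>\<Delta>. \<forall>\<tau>\<in>\<Delta>. \<sigma> \<subseteq> \<tau> \<longrightarrow> \<tau> = \<sigma>}"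

definition primitive_vec :: "nat \<Rightarrow> int vec \<Rightarrow> bool" where
  "primitive_vec r v \<longleftrightarrow> v \<in> carrier_vec r \<and> Gcd {v $ i | i. i < r} = 1"

text \<open>Rays are represented by their primitive generators.\<close>

definition ray_gens :: "nat \<Rightarrow> real vec set set \<Rightarrow> int vec set" where
  "ray_gens r \<Delta> = {v. primitive_vec r v \<and> pos_hull r {v} \<in> \<Delta>}"


section \<open>Torus-invariant divisors\<close>

text \<open>A torus-invariant divisor is its coefficient function on the primitive ray generators;
  values off \<open>ray_gens r \<Delta>\<close> are never used. On a non-singular toric variety every such
  divisor is Cartier.\<close>

type_synonym toric_divisor = "int vec \<Rightarrow> int"

definition prime_divisor :: "int vec \<Rightarrow> toric_divisor" where
  "prime_divisor v = (\<lambda>w. if w = v then 1 else 0)"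

definition polytope :: "nat \<Rightarrow> real vec set set \<Rightarrow> toric_divisor \<Rightarrow> real vec set" where
  "polytope r \<Delta> D =
    {u\<in>carrier_vec r. \<forall>v\<in>ray_gens r \<Delta>. u \<bullet> real_of_int_vec v \<ge> - real_of_int (D v)}"

definition lattice_points :: "nat \<Rightarrow> real vec set set \<Rightarrow> toric_divisor \<Rightarrow> int vec set" where
  "lattice_points r \<Delta> D = {u\<in>carrier_vec r. real_of_int_vec u \<in> polytope r \<Delta> D}"

definition psi :: "nat \<Rightarrow> real vec set set \<Rightarrow> toric_divisor \<Rightarrow> real vec \<Rightarrow> real" where
  "psi r \<Delta> D v = Min ((\<lambda>u. real_of_int_vec u \<bullet> v) ` lattice_points r \<Delta> D)"

text \<open>Fulton's sign convention: the inequality is that of a concave function. The last conjunct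
  says that no linear function represents \<open>\<psi>\<close> on two different maximal cones.\<close>

definition strictly_convex ::
  "nat \<Rightarrow> real vec set set \<Rightarrow> (real vec \<Rightarrow> real) \<Rightarrow> bool" where
  "strictly_convex r \<Delta> \<psi> \<longleftrightarrow>
    (\<forall>v\<in>carrier_vec r. \<forall>w\<in>carrier_vec r. \<forall>s. 0 \<le> s \<and> s \<le> 1 \<longrightarrow>
       \<psi> (s \<cdot>\<^sub>v v + (1 - s) \<cdot>\<^sub>v w) \<ge> s * \<psi> v + (1 - s) * \<psi> w) \<and>
    (\<forall>\<sigma>\<in>maximal_cones \<Delta>. \<exists>m\<in>carrier_vec r. \<forall>v\<in>\<sigma>. \<psi> v = m \<bullet> v) \<and>
    (\<forall>\<sigma>\<in>maximal_cones \<Delta>. \<forall>\<tau>\<in>maximal_cones \<Delta>. \<forall>m\<in>carrier_vec r.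
       (\<forall>v\<in>\<sigma>. \<psi> v = m \<bullet> v) \<and> (\<forall>v\<in>\<tau>. \<psi> v = m \<bullet> v) \<longrightarrow> \<sigma> = \<tau>)"


section \<open>Intersection numbers\<close>

text \<open>
  \<open>\<iota> [v\<^sub>1, \<dots>, v\<^sub>r]\<close> is the degree of
  \<open>V(v\<^sub>1) \<cdots> V(v\<^sub>r)\<close>.
  On a complete non-singular toric variety these numbers are uniquely determined by: symmetry;
  distinct prime divisors meet transversally in the torus-fixed point of the cone they span, or
  not at all; and a principal divisor
  \<open>div(\<chi>\<^sup>u) = \<Sum>\<^sub>\<rho> \<langle>u, v(\<rho>)\<rangle> V(\<rho>)\<close> has intersection number zero
  with everything. (These are the relations of the Jurkiewicz--Danilov presentation of the Chow
  ring.) The first conjunct only fixes junk values.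
\<close>

definition intersection_numbers_of ::
  "nat \<Rightarrow> real vec set set \<Rightarrow> (int vec list \<Rightarrow> int) \<Rightarrow> bool" where
  "intersection_numbers_of r \<Delta> \<iota> \<longleftrightarrow>
    (\<forall>vs. \<not> (length vs = r \<and> set vs \<subseteq> ray_gens r \<Delta>) \<longrightarrow> \<iota> vs = 0) \<and>
    (\<forall>vs ws. mset vs = mset ws \<longrightarrow> \<iota> vs = \<iota> ws) \<and>
    (\<forall>vs. length vs = r \<and> set vs \<subseteq> ray_gens r \<Delta> \<and> distinct vs \<longrightarrow>
       \<iota> vs = (if pos_hull r (set vs) \<in> \<Delta> then 1 else 0)) \<and>
    (\<forall>u\<in>carrier_vec r. \<forall>vs. length vs + 1 = r \<and> set vs \<subseteq> ray_gens r \<Delta> \<longrightarrow>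
       (\<Sum>v\<in>ray_gens r \<Delta>. (u \<bullet> v) * \<iota> (v # vs)) = 0)"

definition intersection_number :: "nat \<Rightarrow> real vec set set \<Rightarrow> int vec list \<Rightarrow> int" where
  "intersection_number r \<Delta> = (THE \<iota>. intersection_numbers_of r \<Delta> \<iota>)"

text \<open>\<open>deg(D\<^sup>r)\<close>, expanded multilinearly.\<close>

definition self_intersection :: "nat \<Rightarrow> real vec set set \<Rightarrow> toric_divisor \<Rightarrow> int" where
  "self_intersection r \<Delta> D =
    (\<Sum>vs | length vs = r \<and> set vs \<subseteq> ray_gens r \<Delta>.
       prod_list (map D vs) * intersection_number r \<Delta> vs)"


section \<open>Toric codes\<close>

text \<open>In this section \<open>K\<close> is the finite field \<open>\<bbbF>\<^sub>q\<close>.\<close>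

definition torus :: "nat \<Rightarrow> ('a, 'b) ring_scheme \<Rightarrow> 'a vec set" where
  "torus r K = {t\<in>carrier_vec r. \<forall>i<r. t $ i \<in> Units K}"

text \<open>Laurent polynomials in the span of the monomials \<open>\<chi>\<^sup>u\<close>, \<open>u \<in> P\<^sub>D \<inter> M\<close>, are given by
  their coefficient functions.\<close>

definition global_sections ::
  "nat \<Rightarrow> ('a, 'b) ring_scheme \<Rightarrow> real vec set set \<Rightarrow> toric_divisor \<Rightarrow> (int vec \<Rightarrow> 'a) set" where
  "global_sections r K \<Delta> D =
    {f. (\<forall>u. f u \<in> carrier K) \<and> (\<forall>u. u \<notin> lattice_points r \<Delta> D \<longrightarrow> f u = \<zero>\<^bsub>K\<^esub>)}"

definition monomial :: "nat \<Rightarrow> ('a, 'b) ring_scheme \<Rightarrow> int vec \<Rightarrow> 'a vec \<Rightarrow> 'a" where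
  "monomial r K u t = finprod K (\<lambda>i. (t $ i) [^]\<^bsub>K\<^esub> (u $ i)) {..<r}"

definition laurent_eval ::
  "nat \<Rightarrow> ('a, 'b) ring_scheme \<Rightarrow> real vec set set \<Rightarrow> toric_divisor \<Rightarrow>
    (int vec \<Rightarrow> 'a) \<Rightarrow> 'a vec \<Rightarrow> 'a" where
  "laurent_eval r K \<Delta> D f t =
    finsum K (\<lambda>u. f u \<otimes>\<^bsub>K\<^esub> monomial r K u t) (lattice_points r \<Delta> D)"

definition toric_code ::
  "nat \<Rightarrow> ('a, 'b) ring_scheme \<Rightarrow> real vec set set \<Rightarrow> toric_divisor \<Rightarrow> ('a vec \<Rightarrow> 'a) set" where
  "toric_code r K \<Delta> D =
    (\<lambda>f. restrict (laurent_eval r K \<Delta> D f) (torus r K)) ` global_sections r K \<Delta> D"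

definition code_length :: "nat \<Rightarrow> ('a, 'b) ring_scheme \<Rightarrow> nat" where
  "code_length r K = card (torus r K)"

definition weight :: "nat \<Rightarrow> ('a, 'b) ring_scheme \<Rightarrow> ('a vec \<Rightarrow> 'a) \<Rightarrow> nat" where
  "weight r K c = card {t\<in>torus r K. c t \<noteq> \<zero>\<^bsub>K\<^esub>}"

definition min_distance ::
  "nat \<Rightarrow> ('a, 'b) ring_scheme \<Rightarrow> real vec set set \<Rightarrow> toric_divisor \<Rightarrow> nat" where
  "min_distance r K \<Delta> D =
    Min (weight r K ` (toric_code r K \<Delta> D - {restrict (\<lambda>_. \<zero>\<^bsub>K\<^esub>) (torus r K)}))"

text \<open>The cycle \<open>E\<close> as a multiplicity function on points. All points involved are
  \<open>\<bbbF>\<^sub>q\<close>-rational, so each has degree one.\<close>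

definition eval_cycle :: "nat \<Rightarrow> ('a, 'b) ring_scheme \<Rightarrow> 'a vec \<Rightarrow> int" where
  "eval_cycle r K = (\<lambda>t. if t \<in> torus r K then 1 else 0)"

definition cycle_degree :: "('p \<Rightarrow> int) \<Rightarrow> int" where
  "cycle_degree Z = (\<Sum>t | Z t \<noteq> 0. Z t)"


section \<open>Joyner's conjecture on the minimum distance\<close>

text \<open>Every finite field is isomorphic to one whose carrier is a set of integers, so fixing the
  type \<open>int\<close> loses no field. Subtraction is in \<open>int\<close> to avoid truncation.\<close>

definition joyner_conjecture :: bool where
  "joyner_conjecture \<longleftrightarrow>
    (\<forall>r \<Delta> D. complete_fan r \<Delta> \<and> nonsingular_fan r \<Delta> \<and> strictly_convex r \<Delta> (psi r \<Delta> D) \<longrightarrow>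
      (\<exists>q0. \<forall>q\<ge>q0. \<forall>K :: int ring.
         field K \<and> finite (carrier K) \<and> card (carrier K) = q \<and>
         cycle_degree (eval_cycle r K) > self_intersection r \<Delta> D \<longrightarrow>
         int (min_distance r K \<Delta> D) \<ge>
           int (code_length r K) - fact r * int (card (lattice_points r \<Delta> D))))"


section \<open>The projective plane\<close>

definition P2_rays :: "int vec set" where
  "P2_rays = {vec_of_list [1, 0], vec_of_list [0, 1], vec_of_list [-1, -1]}"

definition P2_fan :: "real vec set set" where
  "P2_fan = {pos_hull 2 S | S. S \<subset> P2_rays}"

definition P2_divisor :: toric_divisor where
  "P2_divisor = prime_divisor (vec_of_list [-1, -1])"

definition unit_triangle :: "real vec set" where
  "unit_triangle =
    lattice_polytope 2 {vec_of_list [0, 0], vec_of_list [1, 0], vec_of_list [0, 1]}"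

end

theory Submission
  imports "HOL-Number_Theory.Residues" Defs
begin

text \<open>
  A section of \<open>O(1)\<close> restricted to the torus is \<open>a + b t\<^sub>1 + c t\<^sub>2\<close>, and a line
  meets the torus in at most \<open>q - 1\<close> points, with equality for \<open>t\<^sub>1 = 1\<close>.
  So the defect \<open>n - d = q - 1\<close> grows with \<open>q\<close>, while the conjecture bounds it by the constant
  \<open>2! \<cdot> 3 = 6\<close>. The prime fields, realised as residue rings on the integers, refute it for
  arbitrarily large \<open>q\<close>.
\<close>

text \<open>Most of the effort goes into the geometry, because the example must satisfy every
  hypothesis of a conjecture about arbitrary fans. The cones are indexed by the proper subsets of
  three vectors whose only relation, up to scaling, is \<open>e1 + e2 + e3 = 0\<close>. A proper
  subset leaves one coefficient zero, which singles out one representation of each vector by the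
  rays. Membership in a cone then means that certain coefficients vanish, and intersections of
  cones, strong convexity, completeness and the linear pieces of \<open>psi\<close> can be read off
  from these coefficients. The intersection numbers are a definite description, so the degree 1
  requires existence as well as uniqueness. The threshold 8 is where the defect q - 1 first exceeds
  6.\<close>

declare One_nat_def [simp del] \<comment> \<open>keeps the vector index \<open>1\<close> in normal form\<close>

section \<open>Vectors of length two and the three rays\<close>

lemma less_2_iff: "i < 2 \<longleftrightarrow> i = 0 \<or> i = (1::nat)"
  by auto

lemma vec2_eqI:
  assumes "v \<in> carrier_vec 2" "w \<in> carrier_vec 2" "v $ 0 = w $ 0" "v $ 1 = w $ 1"
  shows "v = w"
  using assms by (intro eq_vecI) (auto simp: less_2_iff)

lemma scalar_prod2:
  assumes "w \<in> carrier_vec 2"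
  shows "v \<bullet> w = v $ 0 * w $ 0 + v $ 1 * w $ 1"
  using assms by (simp add: scalar_prod_def numeral_2_eq_2 One_nat_def)

lemma vec_of_list2:
  "vec_of_list [a, b] \<in> carrier_vec 2" "vec_of_list [a, b] $ 0 = a" "vec_of_list [a, b] $ 1 = b"
  "dim_vec (vec_of_list [a, b]) = 2"
  by (simp_all add: index_vec_of_list carrier_vecI del: vec_of_list_Cons)

definition e1 :: "int vec" where "e1 = vec_of_list [1, 0]"
definition e2 :: "int vec" where "e2 = vec_of_list [0, 1]"
definition e3 :: "int vec" where "e3 = vec_of_list [-1, -1]"

lemma ray_entries [simp]:
  "e1 \<in> carrier_vec 2" "e2 \<in> carrier_vec 2" "e3 \<in> carrier_vec 2"
  "dim_vec e1 = 2" "dim_vec e2 = 2" "dim_vec e3 = 2"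
  "e1 $ 0 = 1" "e1 $ 1 = 0" "e2 $ 0 = 0" "e2 $ 1 = 1" "e3 $ 0 = -1" "e3 $ 1 = -1"
  unfolding e1_def e2_def e3_def by (rule vec_of_list2)+

lemma rays_distinct [simp]:
  "e1 \<noteq> e2" "e1 \<noteq> e3" "e2 \<noteq> e3" "e2 \<noteq> e1" "e3 \<noteq> e1" "e3 \<noteq> e2"
  using ray_entries by fastforce+

lemma P2_rays_eq: "P2_rays = {e1, e2, e3}"
  by (simp only: P2_rays_def e1_def e2_def e3_def)

lemma P2_divisor_simps [simp]: "P2_divisor e1 = 0" "P2_divisor e2 = 0" "P2_divisor e3 = 1"
  by (simp_all add: P2_divisor_def prime_divisor_def e3_def[symmetric] del: vec_of_list_Cons)

lemma finite_P2_rays [simp]: "finite P2_rays"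
  by (simp add: P2_rays_eq)

lemma P2_rays_carrier: "P2_rays \<subseteq> carrier_vec 2"
  by (simp add: P2_rays_eq)

text \<open>As \<open>e1 + e2 + e3 = 0\<close>, the coefficients of \<open>v\<close> in the three rays are unique up to a
  common summand; \<open>normal_coord\<close> picks those with minimum \<open>0\<close>.\<close>

definition height :: "real vec \<Rightarrow> real" where
  "height v = min 0 (min (v $ 0) (v $ 1))"

definition normal_coord :: "real vec \<Rightarrow> int vec \<Rightarrow> real" where
  "normal_coord v e = (if e = e1 then v $ 0 else if e = e2 then v $ 1 else 0) - height v"

lemma normal_coord_simps:
  "normal_coord v e1 = v $ 0 - height v" "normal_coord v e2 = v $ 1 - height v"
  "normal_coord v e3 = - height v"
  by (simp_all add: normal_coord_def)

lemma normal_coord_nonneg: "0 \<le> normal_coord v e"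
  by (auto simp: normal_coord_def height_def)

section \<open>Cones generated by lattice vectors and their faces\<close>

lemma pos_hull_carrier: "pos_hull r S \<subseteq> carrier_vec r"
  by (auto simp: pos_hull_def)

lemma pos_hullI:
  "\<forall>s\<in>S. 0 \<le> c s \<Longrightarrow> vec r (\<lambda>i. \<Sum>s\<in>S. c s * real_of_int (s $ i)) \<in> pos_hull r S"
  by (auto simp: pos_hull_def)

lemma pos_hullE:
  assumes "v \<in> pos_hull r S"
  obtains c where "\<forall>s\<in>S. 0 \<le> c s" "v = vec r (\<lambda>i. \<Sum>s\<in>S. c s * real_of_int (s $ i))"
  using assms by (auto simp: pos_hull_def)

text \<open>A representation of \<open>v\<close> by a proper subset, extended by zero, has minimal
  coefficient 0 and is therefore the normalised one. Conversely the normalised coefficients always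
  represent \<open>v\<close>, and those outside \<open>S\<close> may be dropped when they
  vanish.\<close>

lemma pos_hull_P2_iff:
  assumes "S \<subset> P2_rays"
  shows "v \<in> pos_hull 2 S \<longleftrightarrow> v \<in> carrier_vec 2 \<and> (\<forall>e\<in>P2_rays - S. normal_coord v e = 0)"
proof
  assume "v \<in> pos_hull 2 S"
  then obtain c where c: "\<forall>s\<in>S. 0 \<le> c s"
    and v: "v = vec 2 (\<lambda>i. \<Sum>s\<in>S. c s * real_of_int (s $ i))"
    by (blast elim: pos_hullE)
  define c' where "c' s = (if s \<in> S then c s else 0)" for s
  have ext: "v $ i = (\<Sum>s\<in>P2_rays. c' s * real_of_int (s $ i))" if "i < 2" for i
    using that assms by (auto simp: v c'_def intro!: sum.mono_neutral_cong_left)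
  have v01: "v $ 0 = c' e1 - c' e3" "v $ 1 = c' e2 - c' e3"
    using ext[of 0] ext[of 1] by (simp_all add: P2_rays_eq)
  have nonneg: "c' s \<ge> 0" for s using c by (simp add: c'_def)
  have "c' e1 = 0 \<or> c' e2 = 0 \<or> c' e3 = 0"
    using assms by (auto simp: c'_def P2_rays_eq)
  \<comment> \<open>The minimum of 0, \<open>c' e1 - c' e3\<close> and \<open>c' e2 - c' e3\<close>
    is the least coefficient minus \<open>c' e3\<close>, and the least coefficient is 0.\<close>
  then have "height v = - c' e3"
    using nonneg[of e1] nonneg[of e2] nonneg[of e3] by (auto simp: height_def v01)
  then have "\<forall>e\<in>P2_rays. normal_coord v e = c' e"
    by (simp add: P2_rays_eq normal_coord_simps v01)
  then show "v \<in> carrier_vec 2 \<and> (\<forall>e\<in>P2_rays - S. normal_coord v e = 0)"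
    by (auto simp: v c'_def)
next
  assume v: "v \<in> carrier_vec 2 \<and> (\<forall>e\<in>P2_rays - S. normal_coord v e = 0)"
  have "(\<Sum>s\<in>S. normal_coord v s * real_of_int (s $ i)) =
      (\<Sum>s\<in>P2_rays. normal_coord v s * real_of_int (s $ i))" for i
    using v assms by (intro sum.mono_neutral_left) auto
  then have "v = vec 2 (\<lambda>i. \<Sum>s\<in>S. normal_coord v s * real_of_int (s $ i))"
    using v by (intro vec2_eqI) (auto simp: P2_rays_eq normal_coord_simps)
  then show "v \<in> pos_hull 2 S"
    using pos_hullI[of S "normal_coord v" 2] normal_coord_nonneg by simp
qed

text \<open>Vanishing outside \<open>S\<close> together with vanishing outside \<open>T\<close> is
  vanishing outside \<open>S \<inter> T\<close>. This makes the intersection of two cones of the fan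
  a cone of the fan.\<close>

lemma pos_hull_P2_Int:
  assumes "S \<subset> P2_rays" "T \<subset> P2_rays"
  shows "pos_hull 2 S \<inter> pos_hull 2 T = pos_hull 2 (S \<inter> T)"
proof -
  have "S \<inter> T \<subset> P2_rays" using assms by blast
  then show ?thesis
    using pos_hull_P2_iff[of "S \<inter> T"] pos_hull_P2_iff[OF assms(1)] pos_hull_P2_iff[OF assms(2)] by blast
qed

lemma gen_in_pos_hull:
  assumes "finite S" "e \<in> S" "e \<in> carrier_vec r"
  shows "real_of_int_vec e \<in> pos_hull r S"
proof -
  have "real_of_int_vec e = vec r (\<lambda>i. \<Sum>s\<in>S. (if s = e then 1 else 0) * real_of_int (s $ i))"
    using assms by (intro eq_vecI) (auto simp: if_distrib[of "\<lambda>x. x * _"] cong: if_cong)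
  then show ?thesis using pos_hullI[of S "\<lambda>s. if s = e then 1 else 0" r] by simp
qed

lemma pos_hull_mono:
  assumes "S \<subseteq> T" "finite T"
  shows "pos_hull r S \<subseteq> pos_hull r T"
proof
  fix v assume "v \<in> pos_hull r S"
  then obtain c where c: "\<forall>s\<in>S. 0 \<le> c s"
    and v: "v = vec r (\<lambda>i. \<Sum>s\<in>S. c s * real_of_int (s $ i))"
    by (blast elim: pos_hullE)
  have "v = vec r (\<lambda>i. \<Sum>s\<in>T. (if s \<in> S then c s else 0) * real_of_int (s $ i))"
    unfolding v using assms by (intro eq_vecI) (auto intro!: sum.mono_neutral_cong_left)
  then show "v \<in> pos_hull r T" using pos_hullI[of T "\<lambda>s. if s \<in> S then c s else 0" r] c by simp
qed

lemma scalar_prod_pos_comb: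
  assumes "u \<in> carrier_vec r" "S \<subseteq> carrier_vec r"
  shows "u \<bullet> vec r (\<lambda>i. \<Sum>s\<in>S. c s * real_of_int (s $ i)) =
    (\<Sum>s\<in>S. c s * (u \<bullet> real_of_int_vec s))"
proof -
  have "u \<bullet> vec r (\<lambda>i. \<Sum>s\<in>S. c s * real_of_int (s $ i)) =
      (\<Sum>s\<in>S. \<Sum>i<r. u $ i * (c s * real_of_int (s $ i)))"
    by (subst sum.swap) (simp add: scalar_prod_def sum_distrib_left atLeast0LessThan)
  also have "\<dots> = (\<Sum>s\<in>S. c s * (u \<bullet> real_of_int_vec s))"
  proof (intro sum.cong refl)
    fix s assume "s \<in> S"
    then have s: "dim_vec s = r" using assms by auto
    show "(\<Sum>i<r. u $ i * (c s * real_of_int (s $ i))) = c s * (u \<bullet> real_of_int_vec s)"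
      by (auto simp: scalar_prod_def s sum_distrib_left atLeast0LessThan intro!: sum.cong)
  qed
  finally show ?thesis .
qed

text \<open>On a positive combination the functional is a sum of nonnegative terms, which is zero
  only if each term is; so only generators orthogonal to \<open>u\<close> can carry a nonzero
  coefficient.\<close>

lemma pos_hull_supporting_face:
  assumes fin: "finite S" and S: "S \<subseteq> carrier_vec r" and u: "u \<in> carrier_vec r"
    and pos: "\<forall>s\<in>S. 0 \<le> u \<bullet> real_of_int_vec s"
  shows "{v \<in> pos_hull r S. u \<bullet> v = 0} = pos_hull r {s\<in>S. u \<bullet> real_of_int_vec s = 0}"
    (is "?L = pos_hull r ?Z")
proof
  have Z: "?Z \<subseteq> S" by blast
  show "?L \<subseteq> pos_hull r ?Z"
  proof
    fix v assume v: "v \<in> ?L"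
    then obtain c where c: "\<forall>s\<in>S. 0 \<le> c s"
      and veq: "v = vec r (\<lambda>i. \<Sum>s\<in>S. c s * real_of_int (s $ i))"
      by (blast elim: pos_hullE)
    have "(\<Sum>s\<in>S. c s * (u \<bullet> real_of_int_vec s)) = 0"
      using v by (simp add: veq scalar_prod_pos_comb[OF u S])
    then have zero: "c s = 0" if "s \<in> S" "u \<bullet> real_of_int_vec s \<noteq> 0" for s
      using that c pos fin sum_nonneg_eq_0_iff[OF fin, of "\<lambda>s. c s * (u \<bullet> real_of_int_vec s)"]
      by auto
    have "v = vec r (\<lambda>i. \<Sum>s\<in>?Z. c s * real_of_int (s $ i))"
      unfolding veq using fin by (intro eq_vecI) (auto intro!: sum.mono_neutral_right dest: zero)
    then show "v \<in> pos_hull r ?Z" using pos_hullI[of ?Z c r] c by simp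
  qed
  show "pos_hull r ?Z \<subseteq> ?L"
  proof
    fix v assume v: "v \<in> pos_hull r ?Z"
    then obtain c where veq: "v = vec r (\<lambda>i. \<Sum>s\<in>?Z. c s * real_of_int (s $ i))"
      by (blast elim: pos_hullE)
    have "?Z \<subseteq> carrier_vec r" using S by blast
    then have "u \<bullet> v = 0" unfolding veq by (simp add: scalar_prod_pos_comb[OF u])
    then show "v \<in> ?L" using v pos_hull_mono[OF Z fin] by blast
  qed
qed

lemma face_of_pos_hull:
  assumes fin: "finite S" and S: "S \<subseteq> carrier_vec r" and face: "face_of_cone r \<tau> (pos_hull r S)"
  obtains T where "T \<subseteq> S" "\<tau> = pos_hull r T"
proof -
  obtain u where u: "u \<in> carrier_vec r" "\<forall>v\<in>pos_hull r S. 0 \<le> u \<bullet> v"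
    and \<tau>: "\<tau> = {v\<in>pos_hull r S. u \<bullet> v = 0}"
    using face by (auto simp: face_of_cone_def)
  have "\<forall>s\<in>S. 0 \<le> u \<bullet> real_of_int_vec s"
    using u gen_in_pos_hull[OF fin] S by blast
  then show thesis
    using that[of "{s\<in>S. u \<bullet> real_of_int_vec s = 0}"] pos_hull_supporting_face[OF fin S u(1)] \<tau>
    by blast
qed

text \<open>Any two of the three rays form a basis, so the values of a functional on them can be
  prescribed freely. The 0/1 values make every subset of the generators cut out a face.\<close>

lemma P2_separating_functional:
  assumes "S \<subset> P2_rays"
  obtains u where "u \<in> carrier_vec 2"
    "\<forall>s\<in>S. u \<bullet> real_of_int_vec s = (if s \<in> T then 0 else 1)"
proof -
  define w where "w s = (if s \<in> T then 0 else (1::real))" for s :: "int vec"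
  from assms consider "S \<subseteq> {e1, e2}" | "S \<subseteq> {e1, e3}" | "S \<subseteq> {e2, e3}"
    unfolding P2_rays_eq by blast
  then show thesis
  proof cases
    case 1
    show thesis
      by (rule that[of "vec_of_list [w e1, w e2]"]) (use 1 in \<open>auto simp: scalar_prod2 vec_of_list2 w_def simp del: vec_of_list_Cons\<close>)
  next
    case 2
    show thesis
      \<comment> \<open>The second entry solves the equation that the pairing with
        \<open>e3\<close>, which is minus the sum of the entries, equals
        \<open>w e3\<close>.\<close>
      by (rule that[of "vec_of_list [w e1, - w e1 - w e3]"]) (use 2 in \<open>auto simp: scalar_prod2 vec_of_list2 w_def simp del: vec_of_list_Cons\<close>)
  next
    case 3
    show thesis
      by (rule that[of "vec_of_list [- w e2 - w e3, w e2]"]) (use 3 in \<open>auto simp: scalar_prod2 vec_of_list2 w_def simp del: vec_of_list_Cons\<close>)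
  qed
qed

lemma pos_hull_P2_face:
  assumes "S \<subset> P2_rays" "T \<subseteq> S"
  shows "face_of_cone 2 (pos_hull 2 T) (pos_hull 2 S)"
proof -
  obtain u where u: "u \<in> carrier_vec 2"
    and us: "\<forall>s\<in>S. u \<bullet> real_of_int_vec s = (if s \<in> T then 0 else 1)"
    using P2_separating_functional[OF assms(1)] by blast
  have S: "finite S" "S \<subseteq> carrier_vec 2"
    using assms(1) P2_rays_carrier finite_subset[OF _ finite_P2_rays] by blast+
  have "0 \<le> u \<bullet> v" if v: "v \<in> pos_hull 2 S" for v
  proof -
    obtain c where c: "\<forall>s\<in>S. 0 \<le> c s"
      and "v = vec 2 (\<lambda>i. \<Sum>s\<in>S. c s * real_of_int (s $ i))"
      using v by (blast elim: pos_hullE)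
    then show ?thesis
      using us by (auto simp: scalar_prod_pos_comb[OF u S(2)] intro!: sum_nonneg)
  qed
  moreover have "{s\<in>S. u \<bullet> real_of_int_vec s = 0} = T"
    using us assms(2) by (auto split: if_splits)
  moreover have "\<forall>s\<in>S. 0 \<le> u \<bullet> real_of_int_vec s" using us by simp
  ultimately show ?thesis
    using pos_hull_supporting_face[OF S u] u unfolding face_of_cone_def by (intro bexI[of _ u]) auto
qed

section \<open>The fan axioms and completeness\<close>

lemma P2_fan_cases:
  assumes "\<sigma> \<in> P2_fan"
  obtains S where "S \<subset> P2_rays" "\<sigma> = pos_hull 2 S"
  using assms by (auto simp: P2_fan_def)

lemma P2_fan_pos_hull: "S \<subset> P2_rays \<Longrightarrow> pos_hull 2 S \<in> P2_fan"
  by (auto simp: P2_fan_def)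

text \<open>Let \<open>e\<close> be a ray missing from \<open>S\<close>. Its coefficient is zero for
  \<open>v\<close> and for \<open>- v\<close>, so one of the numbers 0, \<open>v $ 0\<close>,
  \<open>v $ 1\<close> is both the minimum and the maximum of the three; hence all are 0.\<close>

lemma P2_cone_strongly_convex:
  assumes S: "S \<subset> P2_rays"
  shows "strongly_convex_cone 2 (pos_hull 2 S)"
  unfolding strongly_convex_cone_def
proof (intro ballI impI)
  fix v assume v: "v \<in> pos_hull 2 S" and nv: "- v \<in> pos_hull 2 S"
  obtain e where e: "e \<in> P2_rays - S" using S by blast
  have carr: "v \<in> carrier_vec 2" using v pos_hull_P2_iff[OF S] by blast
  have "normal_coord v e = 0" "normal_coord (- v) e = 0"
    using v nv e pos_hull_P2_iff[OF S] by blast+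
  moreover have "(- v) $ 0 = - (v $ 0)" "(- v) $ 1 = - (v $ 1)" using carr by auto
  ultimately have "v $ 0 = 0 \<and> v $ 1 = 0"
    using e by (auto simp: P2_rays_eq normal_coord_simps height_def min_def split: if_splits)
  then show "v = 0\<^sub>v 2" using carr by (intro vec2_eqI) auto
qed

lemma complete_fan_P2: "complete_fan 2 P2_fan"
  unfolding complete_fan_def fan_def
proof (intro conjI ballI allI impI)
  have "P2_fan \<subseteq> pos_hull 2 ` Pow P2_rays" by (auto simp: P2_fan_def)
  then show "finite P2_fan" by (rule finite_subset) simp
  show "P2_fan \<noteq> {}" using P2_fan_pos_hull[of "{}"] by (auto simp: P2_rays_eq)
next
  fix \<sigma> assume "\<sigma> \<in> P2_fan"
  then obtain S where S: "S \<subset> P2_rays" and \<sigma>: "\<sigma> = pos_hull 2 S" by (rule P2_fan_cases)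
  have fin: "finite S" and carr: "S \<subseteq> carrier_vec 2"
    using S P2_rays_carrier finite_subset[OF _ finite_P2_rays] by blast+
  show "rational_polyhedral_cone 2 \<sigma>"
    using fin carr \<sigma> by (auto simp: rational_polyhedral_cone_def)
  show "strongly_convex_cone 2 \<sigma>" using P2_cone_strongly_convex[OF S] \<sigma> by simp
  show "\<tau> \<in> P2_fan" if face: "face_of_cone 2 \<tau> \<sigma>" for \<tau>
  proof -
    obtain T where "T \<subseteq> S" "\<tau> = pos_hull 2 T"
      using face_of_pos_hull[OF fin carr] face \<sigma> by blast
    then show ?thesis using S P2_fan_pos_hull by blast
  qed
next
  fix \<sigma> \<tau> assume "\<sigma> \<in> P2_fan" "\<tau> \<in> P2_fan"
  then obtain S T where S: "S \<subset> P2_rays" "\<sigma> = pos_hull 2 S" and T: "T \<subset> P2_rays" "\<tau> = pos_hull 2 T"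
    by (metis P2_fan_cases)
  show "face_of_cone 2 (\<sigma> \<inter> \<tau>) \<sigma>" "face_of_cone 2 (\<sigma> \<inter> \<tau>) \<tau>"
    using S T pos_hull_P2_face[of S "S \<inter> T"] pos_hull_P2_face[of T "S \<inter> T"]
    by (simp_all add: pos_hull_P2_Int)
next
  show "\<Union>P2_fan = carrier_vec 2"
  proof
    show "\<Union>P2_fan \<subseteq> carrier_vec 2" using pos_hull_carrier by (auto simp: P2_fan_def)
    show "carrier_vec 2 \<subseteq> \<Union>P2_fan"
    proof
      fix v :: "real vec" assume v: "v \<in> carrier_vec 2"
      \<comment> \<open>The minimum defining \<open>height\<close> is attained; omitting the ray
        that attains it gives a cone containing \<open>v\<close>.\<close>
      have "\<exists>e\<in>P2_rays. normal_coord v e = 0"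
        by (auto simp: P2_rays_eq normal_coord_simps height_def min_def)
      then obtain e where e: "e \<in> P2_rays" "normal_coord v e = 0" by blast
      then have sub: "P2_rays - {e} \<subset> P2_rays" by blast
      moreover have "v \<in> pos_hull 2 (P2_rays - {e})"
        using v e pos_hull_P2_iff[OF sub] by auto
      ultimately show "v \<in> \<Union>P2_fan" using P2_fan_pos_hull by blast
    qed
  qed
qed

section \<open>Non-singularity and the ray generators\<close>

text \<open>Cramer's rule over the integers: a determinant \<open>d\<close> with
  \<open>d * d = 1\<close> is its own inverse, so multiplying by \<open>d\<close> replaces the
  division. The sign is left open because the pair \<open>e1\<close>, \<open>e3\<close> has
  determinant -1.\<close>

lemma lattice_basis2:
  assumes a: "a \<in> carrier_vec 2" and b: "b \<in> carrier_vec 2"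
    and d: "a $ 0 * b $ 1 - a $ 1 * b $ 0 = d" and d2: "d * d = 1"
  shows "lattice_basis 2 {a, b}"
proof -
  have "a \<noteq> b" using d d2 by (auto simp: mult.commute)
  have dd: "x * (d * (a $ 0 * b $ 1 - a $ 1 * b $ 0)) = x" for x using d d2 by simp
  have "\<exists>!c :: int vec \<Rightarrow> int.
      (\<forall>x. x \<notin> {a, b} \<longrightarrow> c x = 0) \<and> v = vec 2 (\<lambda>i. \<Sum>x\<in>{a, b}. c x * x $ i)"
    if v: "v \<in> carrier_vec 2" for v
  proof (rule ex1I)
    let ?c = "\<lambda>x. if x = a then d * (v $ 0 * b $ 1 - v $ 1 * b $ 0)
      else if x = b then d * (a $ 0 * v $ 1 - a $ 1 * v $ 0) else 0"
    have v01: "d * (v $ 0 * b $ 1 - v $ 1 * b $ 0) * a $ 0 + d * (a $ 0 * v $ 1 - a $ 1 * v $ 0) * b $ 0 = v $ 0"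
      "d * (v $ 0 * b $ 1 - v $ 1 * b $ 0) * a $ 1 + d * (a $ 0 * v $ 1 - a $ 1 * v $ 0) * b $ 1 = v $ 1"
      using dd[of "v $ 0"] dd[of "v $ 1"] by (simp_all add: algebra_simps)
    show "(\<forall>x. x \<notin> {a, b} \<longrightarrow> ?c x = 0) \<and> v = vec 2 (\<lambda>i. \<Sum>x\<in>{a, b}. ?c x * x $ i)"
      using \<open>a \<noteq> b\<close> v by (intro conjI vec2_eqI) (simp_all add: v01)
  next
    fix c assume c: "(\<forall>x. x \<notin> {a, b} \<longrightarrow> c x = 0) \<and> v = vec 2 (\<lambda>i. \<Sum>x\<in>{a, b}. c x * x $ i)"
    have v0: "v $ i = (\<Sum>x\<in>{a, b}. c x * x $ i)" if "i < 2" for i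
      using arg_cong[OF conjunct2[OF c], of "\<lambda>w. w $ i"] that by simp
    have v01: "v $ 0 = c a * a $ 0 + c b * b $ 0" "v $ 1 = c a * a $ 1 + c b * b $ 1"
      using v0[of 0] v0[of 1] \<open>a \<noteq> b\<close> by auto
    have "c a = d * (v $ 0 * b $ 1 - v $ 1 * b $ 0)" "c b = d * (a $ 0 * v $ 1 - a $ 1 * v $ 0)"
      using dd[of "c a"] dd[of "c b"] by (simp_all add: v01 algebra_simps)
    then show "c = (\<lambda>x. if x = a then d * (v $ 0 * b $ 1 - v $ 1 * b $ 0)
      else if x = b then d * (a $ 0 * v $ 1 - a $ 1 * v $ 0) else 0)"
      using conjunct1[OF c] by (intro ext) simp
  qed
  then show ?thesis using a b by (simp add: lattice_basis_def)
qed

lemma nonsingular_fan_P2: "nonsingular_fan 2 P2_fan"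
  unfolding nonsingular_fan_def
proof
  fix \<sigma> assume "\<sigma> \<in> P2_fan"
  then obtain S where S: "S \<subset> P2_rays" and \<sigma>: "\<sigma> = pos_hull 2 S" by (rule P2_fan_cases)
  then have "S \<subseteq> {e1, e2} \<or> S \<subseteq> {e1, e3} \<or> S \<subseteq> {e2, e3}" unfolding P2_rays_eq by blast
  moreover have "lattice_basis 2 {e1, e2}" "lattice_basis 2 {e1, e3}" "lattice_basis 2 {e2, e3}"
    by (rule lattice_basis2[OF _ _ refl]; simp)+
  ultimately show "\<exists>B S. lattice_basis 2 B \<and> S \<subseteq> B \<and> \<sigma> = pos_hull 2 S" using \<sigma> by blast
qed

lemma primitive_vec2_iff:
  "primitive_vec 2 v \<longleftrightarrow> v \<in> carrier_vec 2 \<and> gcd (v $ 0) (v $ 1) = 1"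
proof -
  have "{v $ i | i. i < 2} = {v $ 0, v $ 1}" by (auto simp: less_2_iff)
  then show ?thesis by (simp add: primitive_vec_def)
qed

text \<open>If a primitive \<open>v\<close> spans a cone of the fan, any generator \<open>e\<close>
  of that cone is a nonnegative multiple of \<open>v\<close>. Primitivity of \<open>v\<close> then
  leaves only \<open>v = e\<close>.\<close>

lemma ray_gens_P2: "ray_gens 2 P2_fan = P2_rays"
proof
  show "P2_rays \<subseteq> ray_gens 2 P2_fan"
  proof
    fix e assume e: "e \<in> P2_rays"
    then have "primitive_vec 2 e" by (auto simp: P2_rays_eq primitive_vec2_iff)
    moreover have "{e} \<subset> P2_rays" using e by (auto simp: P2_rays_eq)
    ultimately show "e \<in> ray_gens 2 P2_fan" by (simp add: ray_gens_def P2_fan_pos_hull)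
  qed
  show "ray_gens 2 P2_fan \<subseteq> P2_rays"
  proof
    fix v assume "v \<in> ray_gens 2 P2_fan"
    then have v: "v \<in> carrier_vec 2" "gcd (v $ 0) (v $ 1) = 1" and "pos_hull 2 {v} \<in> P2_fan"
      by (auto simp: ray_gens_def primitive_vec2_iff)
    then obtain S where S: "S \<subset> P2_rays" and vS: "pos_hull 2 {v} = pos_hull 2 S"
      using P2_fan_cases by blast
    \<comment> \<open>The empty set spans the zero cone, whereas a primitive vector is
      nonzero.\<close>
    have "S \<noteq> {}"
    proof
      assume "S = {}"
      then have "real_of_int_vec v \<in> pos_hull 2 {}" using gen_in_pos_hull[of "{v}" v 2] v vS by simp
      then have "real_of_int_vec v = vec 2 (\<lambda>i. 0)" by (auto simp: pos_hull_def)
      then have "real_of_int_vec v $ 0 = 0" "real_of_int_vec v $ 1 = 0" by simp_all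
      then show False using v by simp
    qed
    then obtain e where "e \<in> S" by blast
    then have e: "e \<in> P2_rays" "e \<in> carrier_vec 2" using S P2_rays_carrier by blast+
    have "finite S" using S finite_subset[OF _ finite_P2_rays] by blast
    then have "real_of_int_vec e \<in> pos_hull 2 {v}"
      using gen_in_pos_hull[of S e 2] e \<open>e \<in> S\<close> vS by simp
    then obtain c' where "\<forall>s\<in>{v}. 0 \<le> c' s"
      and "real_of_int_vec e = vec 2 (\<lambda>i. \<Sum>s\<in>{v}. c' s * real_of_int (s $ i))"
      by (rule pos_hullE)
    then obtain c where c: "c \<ge> 0" and ec: "real_of_int_vec e = vec 2 (\<lambda>i. c * real_of_int (v $ i))"
      by (intro that[of "c' v"]) simp_all
    have ec01: "real_of_int (e $ 0) = c * real_of_int (v $ 0)" "real_of_int (e $ 1) = c * real_of_int (v $ 1)"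
      using arg_cong[OF ec, of "\<lambda>x. x $ 0"] arg_cong[OF ec, of "\<lambda>x. x $ 1"] e by simp_all
    \<comment> \<open>The multiplier is positive since \<open>e\<close> is nonzero. So
      \<open>v\<close> inherits from \<open>e\<close> its signs and its zero or equal entries, and
      gcd 1 fixes the scale.\<close>
    have "v = e"
      using e(1) unfolding P2_rays_eq
    proof (elim insertE emptyE)
      assume [simp]: "e = e1"
      have "c > 0" using ec01 c by (cases "c = 0") auto
      then have "v $ 1 = 0" "v $ 0 > 0" using ec01 zero_less_mult_pos[of c "v $ 0"] by auto
      then show "v = e" using v by (intro vec2_eqI) auto
    next
      assume [simp]: "e = e2"
      have "c > 0" using ec01 c by (cases "c = 0") auto
      then have "v $ 0 = 0" "v $ 1 > 0" using ec01 zero_less_mult_pos[of c "v $ 1"] by auto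
      then show "v = e" using v by (intro vec2_eqI) auto
    next
      assume [simp]: "e = e3"
      have "c > 0" using ec01 c by (cases "c = 0") auto
      then have "v $ 1 = v $ 0" "- v $ 0 > 0"
        using ec01 zero_less_mult_pos[of c "- v $ 0"] by auto
      then show "v = e" using v by (intro vec2_eqI) auto
    qed
    then show "v \<in> P2_rays" using e by simp
  qed
qed

section \<open>The polytope and the support function\<close>

lemma polytope_P2_iff:
  "u \<in> polytope 2 P2_fan P2_divisor \<longleftrightarrow>
    u \<in> carrier_vec 2 \<and> 0 \<le> u $ 0 \<and> 0 \<le> u $ 1 \<and> u $ 0 + u $ 1 \<le> 1"
  by (auto simp: polytope_def ray_gens_P2 P2_rays_eq scalar_prod2)

lemma polytope_P2: "polytope 2 P2_fan P2_divisor = unit_triangle"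
proof -
  define o' :: "int vec" where "o' = vec_of_list [0, 0]"
  have [simp]: "o' $ 0 = 0" "o' $ 1 = 0" unfolding o'_def by (rule vec_of_list2)+
  have dist: "o' \<noteq> e1" "o' \<noteq> e2" by (metis \<open>o' $ 0 = 0\<close> \<open>o' $ 1 = 0\<close> ray_entries(7,10) zero_neq_one)+
  have tri: "unit_triangle = lattice_polytope 2 {o', e1, e2}"
    by (simp only: unit_triangle_def o'_def e1_def e2_def)
  show ?thesis
  proof (intro Set.set_eqI iffI)
    fix u assume u: "u \<in> polytope 2 P2_fan P2_divisor"
    \<comment> \<open>Barycentric coordinates: the origin takes the weight left over by the other
      two vertices.\<close>
    define c where "c s = (if s = e1 then u $ 0 else if s = e2 then u $ 1 else 1 - u $ 0 - u $ 1)" for s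
    have "u = vec 2 (\<lambda>i. \<Sum>s\<in>{o', e1, e2}. c s * real_of_int (s $ i))"
      using u dist by (intro vec2_eqI) (auto simp: polytope_P2_iff c_def)
    moreover have "\<forall>s\<in>{o', e1, e2}. 0 \<le> c s" "(\<Sum>s\<in>{o', e1, e2}. c s) = 1"
      using u dist by (auto simp: polytope_P2_iff c_def)
    ultimately show "u \<in> unit_triangle" unfolding tri lattice_polytope_def by blast
  next
    fix u assume "u \<in> unit_triangle"
    then show "u \<in> polytope 2 P2_fan P2_divisor"
      using dist by (auto simp: tri lattice_polytope_def polytope_P2_iff)
  qed
qed

lemma lattice_points_P2: "lattice_points 2 P2_fan P2_divisor = {0\<^sub>v 2, e1, e2}"
proof (intro Set.set_eqI iffI)
  fix u :: "int vec" assume "u \<in> lattice_points 2 P2_fan P2_divisor"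
  then have u: "u \<in> carrier_vec 2" and "0 \<le> real_of_int (u $ 0)" "0 \<le> real_of_int (u $ 1)"
    "real_of_int (u $ 0) + real_of_int (u $ 1) \<le> 1"
    by (auto simp: lattice_points_def polytope_P2_iff)
  then have "0 \<le> u $ 0" "0 \<le> u $ 1" "u $ 0 + u $ 1 \<le> 1" by linarith+
  then consider "u $ 0 = 0" "u $ 1 = 0" | "u $ 0 = 1" "u $ 1 = 0" | "u $ 0 = 0" "u $ 1 = 1" by linarith
  then show "u \<in> {0\<^sub>v 2, e1, e2}"
    by cases (use u in \<open>auto intro: vec2_eqI\<close>)
next
  fix u assume "u \<in> {0\<^sub>v 2, e1, e2}"
  then show "u \<in> lattice_points 2 P2_fan P2_divisor"
    by (auto simp: lattice_points_def polytope_P2_iff)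
qed

lemma lattice_points_distinct [simp]: "0\<^sub>v 2 \<noteq> e1" "0\<^sub>v 2 \<noteq> e2" "e1 \<noteq> 0\<^sub>v 2" "e2 \<noteq> 0\<^sub>v 2"
  by (metis index_zero_vec(1) pos2 one_less_numeral_iff semiring_norm(76) ray_entries(7,10) zero_neq_one)+

lemma card_lattice_points_P2: "card (lattice_points 2 P2_fan P2_divisor) = 3"
  by (simp add: lattice_points_P2)

text \<open>The three lattice points pair with \<open>v\<close> to 0, \<open>v $ 0\<close> and
  \<open>v $ 1\<close>. So the normalising shift of the cone coordinates is the support function
  itself, and a vanishing coefficient tells which linear function attains the minimum.\<close>

lemma psi_P2: "v \<in> carrier_vec 2 \<Longrightarrow> psi 2 P2_fan P2_divisor v = height v"
  by (simp add: psi_def lattice_points_P2 height_def scalar_prod2)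

lemma strictly_convex_P2: "strictly_convex 2 P2_fan (psi 2 P2_fan P2_divisor)"
  unfolding strictly_convex_def
proof (intro conjI ballI allI impI)
  fix v w :: "real vec" and s :: real
  assume v: "v \<in> carrier_vec 2" and w: "w \<in> carrier_vec 2" and s: "0 \<le> s \<and> s \<le> 1"
  \<comment> \<open>Concavity of a minimum of three linear functions: the convex combination is
    bounded by each of the three in turn.\<close>
  have "s * height v \<le> s * x" if "x = 0 \<or> x = v $ 0 \<or> x = v $ 1" for x
    using that s by (intro mult_left_mono) (auto simp: height_def)
  moreover have "(1 - s) * height w \<le> (1 - s) * x" if "x = 0 \<or> x = w $ 0 \<or> x = w $ 1" for x
    using that s by (intro mult_left_mono) (auto simp: height_def)
  ultimately have "s * height v + (1 - s) * height w \<le> s * x + (1 - s) * y"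
    if "x = 0 \<and> y = 0 \<or> x = v $ 0 \<and> y = w $ 0 \<or> x = v $ 1 \<and> y = w $ 1" for x y
    using that add_mono by metis
  from this[of 0 0] this[of "v $ 0" "w $ 0"] this[of "v $ 1" "w $ 1"]
  have "s * height v + (1 - s) * height w \<le> height (s \<cdot>\<^sub>v v + (1 - s) \<cdot>\<^sub>v w)"
    using v w by (simp add: height_def[of "_ + _"])
  then show "s * psi 2 P2_fan P2_divisor v + (1 - s) * psi 2 P2_fan P2_divisor w
      \<le> psi 2 P2_fan P2_divisor (s \<cdot>\<^sub>v v + (1 - s) \<cdot>\<^sub>v w)"
    using v w by (simp add: psi_P2)
next
  fix \<sigma> assume "\<sigma> \<in> maximal_cones P2_fan"
  then obtain S where S: "S \<subset> P2_rays" and \<sigma>: "\<sigma> = pos_hull 2 S"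
    by (metis (no_types, lifting) P2_fan_cases maximal_cones_def mem_Collect_eq)
  obtain e where e: "e \<in> P2_rays - S" using S by blast
  \<comment> \<open>The lattice point of the triangle attached to the missing ray: \<open>e1\<close>
    or \<open>e2\<close> for these rays, the origin for \<open>e3\<close>. On the cone it attains
    the minimum.\<close>
  define m :: "real vec" where "m = vec_of_list [if e = e1 then 1 else 0, if e = e2 then 1 else 0]"
  have m: "m \<in> carrier_vec 2" "m $ 0 = (if e = e1 then 1 else 0)" "m $ 1 = (if e = e2 then 1 else 0)"
    unfolding m_def by (rule vec_of_list2)+
  have "psi 2 P2_fan P2_divisor v = m \<bullet> v" if "v \<in> \<sigma>" for v
  proof -
    have "v \<in> carrier_vec 2" "normal_coord v e = 0"
      using that e pos_hull_P2_iff[OF S] \<sigma> by blast+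
    then show ?thesis
      using m by (auto simp: psi_P2 normal_coord_def scalar_prod2 split: if_splits)
  qed
  then show "\<exists>m\<in>carrier_vec 2. \<forall>v\<in>\<sigma>. psi 2 P2_fan P2_divisor v = m \<bullet> v" using m by blast
next
  fix \<sigma> \<tau> and m :: "real vec"
  assume max: "\<sigma> \<in> maximal_cones P2_fan" "\<tau> \<in> maximal_cones P2_fan"
    and m: "(\<forall>v\<in>\<sigma>. psi 2 P2_fan P2_divisor v = m \<bullet> v) \<and> (\<forall>v\<in>\<tau>. psi 2 P2_fan P2_divisor v = m \<bullet> v)"
  obtain S T where S: "S \<subset> P2_rays" "\<sigma> = pos_hull 2 S" and T: "T \<subset> P2_rays" "\<tau> = pos_hull 2 T"
    using max by (metis (no_types, lifting) P2_fan_cases maximal_cones_def mem_Collect_eq)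
  have fin: "finite S" "finite T" using S T finite_subset[OF _ finite_P2_rays] by blast+
  \<comment> \<open>A common linear function on all three rays would have values summing to 0, as
    the rays do, but \<open>height\<close> takes the values 0, 0, -1. So some ray is missing from
    both sets, their union spans a cone of the fan, and maximality identifies both cones with
    it.\<close>
  have "S \<union> T \<noteq> P2_rays"
  proof
    assume "S \<union> T = P2_rays"
    then have "height (real_of_int_vec e) = m \<bullet> real_of_int_vec e" if "e \<in> P2_rays" for e
      using that m S T gen_in_pos_hull[OF fin(1), of e 2] gen_in_pos_hull[OF fin(2), of e 2]
        P2_rays_carrier psi_P2[of "real_of_int_vec e"] by (metis UnE map_carrier_vec subset_iff)
    from this[of e1] this[of e2] this[of e3] show False
      by (simp add: P2_rays_eq height_def scalar_prod2)
  qed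
  then have ST: "pos_hull 2 (S \<union> T) \<in> P2_fan" using S T by (intro P2_fan_pos_hull) blast
  have "pos_hull 2 S \<subseteq> pos_hull 2 (S \<union> T)" "pos_hull 2 T \<subseteq> pos_hull 2 (S \<union> T)"
    using fin by (simp_all add: pos_hull_mono)
  then have "pos_hull 2 (S \<union> T) = \<sigma>" "pos_hull 2 (S \<union> T) = \<tau>"
    using max ST S T by (auto simp: maximal_cones_def)
  then show "\<sigma> = \<tau>" by simp
qed

section \<open>Intersection numbers on the projective plane\<close>

lemma P2_pair_subset:
  assumes "length vs = 2" "set vs \<subseteq> P2_rays"
  shows "set vs \<subset> P2_rays"
proof -
  have "card (set vs) \<le> 2" using assms(1) card_length by metis
  moreover have "card P2_rays = 3" by (simp add: P2_rays_eq)
  ultimately show ?thesis using assms(2) by auto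
qed

text \<open>On \<open>\<P>\<^sup>2\<close> all three rays have the class of a line, so any two (possibly equal)
  prime divisors meet with multiplicity \<open>1\<close>.\<close>

definition P2_intersection :: "int vec list \<Rightarrow> int" where
  "P2_intersection vs = (if length vs = 2 \<and> set vs \<subseteq> P2_rays then 1 else 0)"

lemma intersection_numbers_of_P2: "intersection_numbers_of 2 P2_fan P2_intersection"
  unfolding intersection_numbers_of_def ray_gens_P2
proof (intro conjI allI ballI impI)
  fix vs ws :: "int vec list" assume "mset vs = mset ws"
  then show "P2_intersection vs = P2_intersection ws"
    unfolding P2_intersection_def by (metis mset_eq_length mset_eq_setD)
next
  fix vs assume "length vs = 2 \<and> set vs \<subseteq> P2_rays \<and> distinct vs"
  then show "P2_intersection vs = (if pos_hull 2 (set vs) \<in> P2_fan then 1 else 0)"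
    using P2_fan_pos_hull[OF P2_pair_subset] by (simp add: P2_intersection_def)
next
  fix u :: "int vec" and vs assume "length vs + 1 = 2 \<and> set vs \<subseteq> P2_rays"
  then have "P2_intersection (v # vs) = 1" if "v \<in> P2_rays" for v
    using that by (simp add: P2_intersection_def)
  then have "(\<Sum>v\<in>P2_rays. u \<bullet> v * P2_intersection (v # vs)) = (\<Sum>v\<in>P2_rays. u \<bullet> v)"
    by simp
  \<comment> \<open>The principal divisor relation reduces to
    \<open>e1 + e2 + e3 = 0\<close>.\<close>
  also have "\<dots> = 0" by (simp add: P2_rays_eq scalar_prod2)
  finally show "(\<Sum>v\<in>P2_rays. u \<bullet> v * P2_intersection (v # vs)) = 0" .
qed (auto simp: P2_intersection_def)

text \<open>Two distinct rays always span a cone, so their number is prescribed. The principal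
  relations make the three divisors interchangeable in the first argument, which turns a
  self-intersection into a transversal one.\<close>

lemma intersection_numbers_of_P2_unique:
  assumes "intersection_numbers_of 2 P2_fan \<iota>"
  shows "\<iota> = P2_intersection"
proof
  fix vs
  have junk: "\<iota> vs = 0" if "\<not> (length vs = 2 \<and> set vs \<subseteq> P2_rays)"
    using assms that unfolding intersection_numbers_of_def ray_gens_P2 by blast
  have distinct_spec: "\<iota> vs = (if pos_hull 2 (set vs) \<in> P2_fan then 1 else 0)"
    if "length vs = 2 \<and> set vs \<subseteq> P2_rays \<and> distinct vs" for vs
    using assms that unfolding intersection_numbers_of_def ray_gens_P2 by blast
  have transversal: "\<iota> [a, b] = 1" if "a \<in> P2_rays" "b \<in> P2_rays" "a \<noteq> b" for a b
  proof -
    have "length [a, b] = 2 \<and> set [a, b] \<subseteq> P2_rays \<and> distinct [a, b]" using that by simp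
    moreover from this have "pos_hull 2 (set [a, b]) \<in> P2_fan"
      using P2_fan_pos_hull[OF P2_pair_subset] by blast
    ultimately show ?thesis using distinct_spec by simp
  qed
  have principal: "(\<Sum>v\<in>P2_rays. u \<bullet> v * \<iota> [v, w]) = 0"
    if "u \<in> carrier_vec 2" "w \<in> P2_rays" for u w
  proof -
    have "length [w] + 1 = 2 \<and> set [w] \<subseteq> P2_rays" using that by simp
    then show ?thesis
      using assms that(1) unfolding intersection_numbers_of_def ray_gens_P2 by blast
  qed
  \<comment> \<open>Here \<open>e1\<close> and \<open>e2\<close> are used as characters, namely the
    coordinates t_1 and t_2, whose divisors are V(\<open>e1\<close>) - V(\<open>e3\<close>) and
    V(\<open>e2\<close>) - V(\<open>e3\<close>).\<close>
  have same: "\<iota> [e1, w] = \<iota> [e3, w]" "\<iota> [e2, w] = \<iota> [e3, w]" if "w \<in> P2_rays" for w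
    using principal[of e1 w] principal[of e2 w] that by (simp_all add: P2_rays_eq scalar_prod2)
  have "\<iota> [a, b] = 1" if ab: "a \<in> P2_rays" "b \<in> P2_rays" for a b
  proof (cases "a = b")
    case True
    have "e1 \<in> P2_rays" "e2 \<in> P2_rays" "e3 \<in> P2_rays" by (simp_all add: P2_rays_eq)
    then have "\<iota> [e1, e1] = 1" "\<iota> [e2, e2] = 1" "\<iota> [e3, e3] = 1"
      using same transversal rays_distinct by metis+
    then show ?thesis using ab True by (auto simp: P2_rays_eq)
  qed (use transversal ab in blast)
  then show "\<iota> vs = P2_intersection vs"
    using junk by (cases "length vs = 2") (auto simp: P2_intersection_def length_Suc_conv numeral_2_eq_2)
qed

lemma intersection_number_P2: "intersection_number 2 P2_fan = P2_intersection"
  unfolding intersection_number_def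
  using intersection_numbers_of_P2 intersection_numbers_of_P2_unique by (rule the_equality)

lemma self_intersection_P2: "self_intersection 2 P2_fan P2_divisor = 1"
proof -
  let ?V = "{vs. length vs = 2 \<and> set vs \<subseteq> P2_rays}"
  let ?f = "\<lambda>vs. prod_list (map P2_divisor vs) * P2_intersection vs"
  have fin: "finite ?V" using finite_lists_length_eq[OF finite_P2_rays, of 2] by (simp add: conj_commute)
  have in_V: "[e3, e3] \<in> ?V" by (simp add: P2_rays_eq)
  \<comment> \<open>The divisor has coefficient 0 at \<open>e1\<close> and \<open>e2\<close>, so
    only the repeated \<open>e3\<close> contributes.\<close>
  have "?f vs = 0" if "vs \<in> ?V - {[e3, e3]}" for vs
  proof -
    have "length vs = Suc (Suc 0)" "set vs \<subseteq> P2_rays" using that by auto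
    then obtain a b where vs: "vs = [a, b]" and "a \<in> P2_rays" "b \<in> P2_rays"
      by (auto simp: length_Suc_conv)
    moreover have "\<not> (a = e3 \<and> b = e3)" using that vs by blast
    ultimately show ?thesis by (auto simp: P2_rays_eq)
  qed
  then have "sum ?f ?V = sum ?f {[e3, e3]}"
    using fin in_V by (intro sum.mono_neutral_right) auto
  also have "\<dots> = 1" using in_V by (simp add: P2_intersection_def)
  finally show ?thesis
    by (simp add: self_intersection_def ray_gens_P2 intersection_number_P2)
qed

section \<open>Points of the torus\<close>

lemma torus2_iff: "t \<in> torus 2 K \<longleftrightarrow> t \<in> carrier_vec 2 \<and> t $ 0 \<in> Units K \<and> t $ 1 \<in> Units K"
  by (auto simp: torus_def less_2_iff)

lemma torus2_eqI:
  "s \<in> torus 2 K \<Longrightarrow> t \<in> torus 2 K \<Longrightarrow> s $ 0 = t $ 0 \<Longrightarrow> s $ 1 = t $ 1 \<Longrightarrow> s = t"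
  by (auto simp: torus2_iff intro: vec2_eqI)

lemma bij_betw_torus2: "bij_betw (\<lambda>t. (t $ 0, t $ 1)) (torus 2 K) (Units K \<times> Units K)"
proof (rule bij_betw_imageI)
  show "inj_on (\<lambda>t. (t $ 0, t $ 1)) (torus 2 K)" by (auto intro!: inj_onI torus2_eqI)
  have "(a, b) \<in> (\<lambda>t. (t $ 0, t $ 1)) ` torus 2 K" if "a \<in> Units K" "b \<in> Units K" for a b
    using that by (intro image_eqI[of _ _ "vec_of_list [a, b]"])
      (simp_all add: torus2_iff vec_of_list2 del: vec_of_list_Cons)
  then show "(\<lambda>t. (t $ 0, t $ 1)) ` torus 2 K = Units K \<times> Units K"
    by (auto simp: torus2_iff)
qed

lemma card_torus2: "card (torus 2 K) = card (Units K) * card (Units K)"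
  using bij_betw_same_card[OF bij_betw_torus2] by (simp add: card_cartesian_product)

lemma finite_torus2: "finite (Units K) \<Longrightarrow> finite (torus 2 K)"
  by (simp add: bij_betw_finite[OF bij_betw_torus2])

lemma card_torus2_le:
  assumes "Z \<subseteq> torus 2 K" "finite (Units K)" "inj_on (\<lambda>t. t $ i) Z" "i < 2"
  shows "card Z \<le> card (Units K)"
  using assms by (intro card_inj_on_le[of "\<lambda>t. t $ i"]) (auto simp: torus2_iff less_2_iff)

lemma cycle_degree_eval_cycle: "cycle_degree (eval_cycle r K) = int (card (torus r K))"
  by (simp add: cycle_degree_def eval_cycle_def)

lemma finite_Units: "finite (carrier K) \<Longrightarrow> finite (Units K)"
  by (rule finite_subset[of _ "carrier K"]) (auto simp: Units_def)

section \<open>The code over a finite field\<close>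

context field
begin

lemma torus2_carrier: "t \<in> torus 2 R \<Longrightarrow> t $ 0 \<in> carrier R \<and> t $ 1 \<in> carrier R"
  by (auto simp: torus2_iff)

lemma monomial2:
  assumes "t \<in> torus 2 R"
  shows "monomial 2 R (0\<^sub>v 2) t = \<one>" "monomial 2 R e1 t = t $ 0" "monomial 2 R e2 t = t $ 1"
proof -
  have pow: "x [^] (0::int) = \<one>" "x [^] (1::int) = x" if "x \<in> carrier R" for x
    using int_pow_int[of R x 0] int_pow_int[of R x 1] that by simp_all
  have t: "t $ 0 \<in> carrier R" "t $ 1 \<in> carrier R" using torus2_carrier[OF assms] by auto
  have two: "{..<2::nat} = {0, 1}" by auto
  show "monomial 2 R (0\<^sub>v 2) t = \<one>" "monomial 2 R e1 t = t $ 0" "monomial 2 R e2 t = t $ 1"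
    unfolding monomial_def two using t by (simp_all add: pow finprod_insert)
qed

lemma laurent_eval_P2:
  assumes "f \<in> global_sections 2 R P2_fan P2_divisor" "t \<in> torus 2 R"
  shows "laurent_eval 2 R P2_fan P2_divisor f t = f (0\<^sub>v 2) \<oplus> (f e1 \<otimes> t $ 0 \<oplus> f e2 \<otimes> t $ 1)"
proof -
  have "f u \<in> carrier R" for u using assms(1) by (simp add: global_sections_def)
  then show ?thesis
    using torus2_carrier[OF assms(2)]
    by (simp add: laurent_eval_def lattice_points_P2 monomial2[OF assms(2)] finsum_insert)
qed

text \<open>A coordinate that occurs in the equation of a line is determined by the other one.\<close>

lemma card_zeros_le:
  assumes fin: "finite (carrier R)" and f: "f \<in> global_sections 2 R P2_fan P2_divisor"
    and nz: "\<exists>t\<in>torus 2 R. laurent_eval 2 R P2_fan P2_divisor f t \<noteq> \<zero>"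
  shows "card {t\<in>torus 2 R. laurent_eval 2 R P2_fan P2_divisor f t = \<zero>} \<le> card (Units R)"
    (is "card ?Z \<le> _")
proof -
  have c: "f u \<in> carrier R" for u using f by (simp add: global_sections_def)
  have Z: "?Z \<subseteq> torus 2 R" by blast
  have ZD: "t \<in> torus 2 R" "f (0\<^sub>v 2) \<oplus> (f e1 \<otimes> t $ 0 \<oplus> f e2 \<otimes> t $ 1) = \<zero>"
    "t $ 0 \<in> carrier R" "t $ 1 \<in> carrier R" if "t \<in> ?Z" for t
    using that laurent_eval_P2[OF f, of t] torus2_carrier[of t] by auto
  consider (y) "f e2 \<noteq> \<zero>" | (x) "f e1 \<noteq> \<zero>" | (const) "f e1 = \<zero>" "f e2 = \<zero>" by blast
  then show ?thesis
  proof cases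
    case y
    have "inj_on (\<lambda>t. t $ 0) ?Z"
    proof (rule inj_onI)
      fix s t assume s: "s \<in> ?Z" and t: "t \<in> ?Z" and eq: "s $ 0 = t $ 0"
      have "f (0\<^sub>v 2) \<oplus> (f e1 \<otimes> s $ 0 \<oplus> f e2 \<otimes> s $ 1) = f (0\<^sub>v 2) \<oplus> (f e1 \<otimes> s $ 0 \<oplus> f e2 \<otimes> t $ 1)"
        using ZD(2)[OF s] ZD(2)[OF t] eq by simp
      then have "f e2 \<otimes> s $ 1 = f e2 \<otimes> t $ 1"
        using c ZD(3,4)[OF s] ZD(3,4)[OF t] by simp
      then have "s $ 1 = t $ 1" using y c ZD(4)[OF s] ZD(4)[OF t] m_lcancel by blast
      then show "s = t" using torus2_eqI ZD(1)[OF s] ZD(1)[OF t] eq by blast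
    qed
    then show ?thesis using card_torus2_le[OF Z finite_Units[OF fin]] by simp
  next
    case x
    have "inj_on (\<lambda>t. t $ 1) ?Z"
    proof (rule inj_onI)
      fix s t assume s: "s \<in> ?Z" and t: "t \<in> ?Z" and eq: "s $ 1 = t $ 1"
      have "f (0\<^sub>v 2) \<oplus> (f e1 \<otimes> s $ 0 \<oplus> f e2 \<otimes> s $ 1) = f (0\<^sub>v 2) \<oplus> (f e1 \<otimes> t $ 0 \<oplus> f e2 \<otimes> s $ 1)"
        using ZD(2)[OF s] ZD(2)[OF t] eq by simp
      then have "f e1 \<otimes> s $ 0 = f e1 \<otimes> t $ 0"
        using c ZD(3,4)[OF s] ZD(3,4)[OF t] by simp
      then have "s $ 0 = t $ 0" using x c ZD(3)[OF s] ZD(3)[OF t] m_lcancel by blast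
      then show "s = t" using torus2_eqI ZD(1)[OF s] ZD(1)[OF t] eq by blast
    qed
    then show ?thesis using card_torus2_le[OF Z finite_Units[OF fin]] by simp
  next
    \<comment> \<open>A constant section that is nonzero somewhere on the torus has no zeros
      there.\<close>
    case const
    then have "laurent_eval 2 R P2_fan P2_divisor f t = f (0\<^sub>v 2)" if "t \<in> torus 2 R" for t
      using laurent_eval_P2[OF f that] torus2_carrier[OF that] c by simp
    then have "?Z = {}" using nz by auto
    then show ?thesis by (simp only: card.empty)
  qed
qed

lemma weight_codeword:
  assumes "finite (carrier R)"
  shows "weight 2 R (restrict g (torus 2 R)) =
    card (Units R) * card (Units R) - card {t\<in>torus 2 R. g t = \<zero>}"
proof -
  have "weight 2 R (restrict g (torus 2 R)) = card (torus 2 R - {t\<in>torus 2 R. g t = \<zero>})"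
    by (auto simp: weight_def intro: arg_cong[of _ _ card])
  then show ?thesis
    using finite_torus2[OF finite_Units[OF assms]]
    by (simp add: card_Diff_subset card_torus2[symmetric])
qed

text \<open>The lower bound is the count of zeros on a line; the line t_1 = 1 attains it. With a
  single unit, t_1 - 1 would vanish on the whole torus and its codeword would be zero, whence the
  assumption on \<open>Units R\<close>.\<close>

lemma min_distance_P2:
  assumes fin: "finite (carrier R)" and units: "card (Units R) > 1"
  shows "min_distance 2 R P2_fan P2_divisor = card (Units R) * card (Units R) - card (Units R)"
  unfolding min_distance_def
proof (rule Min_eqI)
  let ?C = "toric_code 2 R P2_fan P2_divisor - {restrict (\<lambda>_. \<zero>) (torus 2 R)}"
  have fT: "finite (torus 2 R)" by (rule finite_torus2[OF finite_Units[OF fin]])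
  have "weight 2 R ` ?C \<subseteq> {..card (torus 2 R)}"
    using fT by (auto simp: weight_def intro!: card_mono)
  then show "finite (weight 2 R ` ?C)" by (rule finite_subset) simp
  show "card (Units R) * card (Units R) - card (Units R) \<le> w" if w: "w \<in> weight 2 R ` ?C" for w
  proof -
    obtain f where f: "f \<in> global_sections 2 R P2_fan P2_divisor"
      and w_eq: "w = weight 2 R (restrict (laurent_eval 2 R P2_fan P2_divisor f) (torus 2 R))"
      and ne: "restrict (laurent_eval 2 R P2_fan P2_divisor f) (torus 2 R) \<noteq>
        restrict (\<lambda>_. \<zero>) (torus 2 R)"
      using w by (auto simp: toric_code_def)
    have "\<exists>t\<in>torus 2 R. laurent_eval 2 R P2_fan P2_divisor f t \<noteq> \<zero>"
      using ne by (meson restrict_ext)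
    then show ?thesis
      unfolding w_eq weight_codeword[OF fin] using card_zeros_le[OF fin f] by simp
  qed
  \<comment> \<open>The section t_1 - 1; the points of the torus with first coordinate one are
    parametrised by the second.\<close>
  define f where "f u = (if u = 0\<^sub>v 2 then \<ominus> \<one> else if u = e1 then \<one> else \<zero>)" for u
  have f: "f \<in> global_sections 2 R P2_fan P2_divisor"
    by (auto simp: global_sections_def f_def lattice_points_P2)
  have eval: "laurent_eval 2 R P2_fan P2_divisor f t = t $ 0 \<ominus> \<one>" if "t \<in> torus 2 R" for t
    using laurent_eval_P2[OF f that] torus2_carrier[OF that]
    by (simp add: f_def minus_eq a_comm)
  have zero_iff: "laurent_eval 2 R P2_fan P2_divisor f t = \<zero> \<longleftrightarrow> t $ 0 = \<one>" if "t \<in> torus 2 R" for t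
    using eval[OF that] torus2_carrier[OF that] by simp
  let ?Z = "{t\<in>torus 2 R. laurent_eval 2 R P2_fan P2_divisor f t = \<zero>}"
  have "(\<lambda>b. vec_of_list [\<one>, b]) ` Units R \<subseteq> ?Z"
    using zero_iff by (auto simp: torus2_iff vec_of_list2 simp del: vec_of_list_Cons)
  moreover have "inj_on (\<lambda>b. vec_of_list [\<one>, b]) (Units R)" by (auto intro: inj_onI)
  ultimately have ge: "card (Units R) \<le> card ?Z"
    using fT by (intro card_inj_on_le[of "\<lambda>b. vec_of_list [\<one>, b]"]) auto
  have "inj_on (\<lambda>t. t $ 1) ?Z"
    using zero_iff by (auto intro!: inj_onI torus2_eqI)
  then have "card ?Z = card (Units R)"
    using ge card_torus2_le[of ?Z R 1] finite_Units[OF fin] by fastforce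
  then have "weight 2 R (restrict (laurent_eval 2 R P2_fan P2_divisor f) (torus 2 R)) =
      card (Units R) * card (Units R) - card (Units R)"
    by (simp add: weight_codeword[OF fin])
  moreover have "restrict (laurent_eval 2 R P2_fan P2_divisor f) (torus 2 R) \<noteq>
      restrict (\<lambda>_. \<zero>) (torus 2 R)"
  proof
    assume "restrict (laurent_eval 2 R P2_fan P2_divisor f) (torus 2 R) =
      restrict (\<lambda>_. \<zero>) (torus 2 R)"
    \<comment> \<open>The zero codeword has weight 0, but the weight just computed is positive as
      soon as there are two units.\<close>
    then have "card (Units R) * card (Units R) - card (Units R) = 0"
      using calculation by (simp add: weight_codeword[OF fin] card_torus2)
    moreover have "card (Units R) * 1 < card (Units R) * card (Units R)"
      using units by (intro mult_strict_left_mono) auto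
    ultimately show False by simp
  qed
  ultimately show "card (Units R) * card (Units R) - card (Units R) \<in> weight 2 R ` ?C"
    using f unfolding toric_code_def by (metis (no_types, lifting) DiffI image_eqI singletonD)
qed

lemma card_Units: "finite (carrier R) \<Longrightarrow> card (Units R) = card (carrier R) - 1"
  using field_Units by (simp add: card_Diff_singleton)

end

section \<open>Parameters of the code and the refutation\<close>

lemma P2_code_parameters:
  assumes K: "field K" "finite (carrier K)" "card (carrier K) = q" and q: "q \<ge> 8"
  shows "int (code_length 2 K) = (int q - 1)\<^sup>2"
    and "cycle_degree (eval_cycle 2 K) = (int q - 1)\<^sup>2"
    and "int (min_distance 2 K P2_fan P2_divisor) = (int q - 1)\<^sup>2 - (int q - 1)"
proof -
  have units: "card (Units K) = q - 1" using field.card_Units[OF K(1,2)] K(3) by simp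
  have le: "q - 1 \<le> (q - 1) * (q - 1)" by (rule le_square)
  have "card (Units K) > 1" using q units by linarith
  then have "min_distance 2 K P2_fan P2_divisor = (q - 1) * (q - 1) - (q - 1)"
    using field.min_distance_P2[OF K(1,2)] units by metis
  \<comment> \<open>The distance is a truncated difference of naturals; \<open>le\<close> guarantees
    that it agrees with the integer one.\<close>
  then have "int (min_distance 2 K P2_fan P2_divisor) = int (q - 1) * int (q - 1) - int (q - 1)"
    using of_nat_diff[OF le] by simp
  moreover have "int (q - 1) = int q - 1" using q by linarith
  ultimately show "int (min_distance 2 K P2_fan P2_divisor) = (int q - 1)\<^sup>2 - (int q - 1)"
    by (simp add: power2_eq_square)
  show "int (code_length 2 K) = (int q - 1)\<^sup>2" "cycle_degree (eval_cycle 2 K) = (int q - 1)\<^sup>2"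
    using q units
    by (simp_all add: code_length_def cycle_degree_eval_cycle card_torus2 of_nat_diff power2_eq_square)
qed

lemma P2_code_bounds:
  assumes K: "field K" "finite (carrier K)" "card (carrier K) = q" and q: "q \<ge> 8"
  shows "cycle_degree (eval_cycle 2 K) > self_intersection 2 P2_fan P2_divisor"
    and "int (code_length 2 K) - fact 2 * int (card (lattice_points 2 P2_fan P2_divisor)) =
      (int q - 1)\<^sup>2 - 6"
    and "int (min_distance 2 K P2_fan P2_divisor) <
      int (code_length 2 K) - fact 2 * int (card (lattice_points 2 P2_fan P2_divisor))"
proof -
  have "7\<^sup>2 \<le> (int q - 1)\<^sup>2" using q by (intro power_mono) auto
  then show "cycle_degree (eval_cycle 2 K) > self_intersection 2 P2_fan P2_divisor"
    by (simp add: P2_code_parameters[OF assms] self_intersection_P2)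
  show "int (code_length 2 K) - fact 2 * int (card (lattice_points 2 P2_fan P2_divisor)) =
      (int q - 1)\<^sup>2 - 6"
    by (simp add: P2_code_parameters[OF assms] card_lattice_points_P2)
  show "int (min_distance 2 K P2_fan P2_divisor) <
      int (code_length 2 K) - fact 2 * int (card (lattice_points 2 P2_fan P2_divisor))"
    \<comment> \<open>After cancelling the square this is 6 < q - 1, which is exactly the assumption
      on \<open>q\<close>.\<close>
    using q by (simp add: P2_code_parameters[OF assms] card_lattice_points_P2)
qed

lemma not_joyner_conjecture: "\<not> joyner_conjecture"
proof
  assume joyner_conjecture
  then obtain q0 where q0: "\<And>q (K :: int ring). q \<ge> q0 \<Longrightarrow>
      field K \<Longrightarrow> finite (carrier K) \<Longrightarrow> card (carrier K) = q \<Longrightarrow>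
      cycle_degree (eval_cycle 2 K) > self_intersection 2 P2_fan P2_divisor \<Longrightarrow>
      int (min_distance 2 K P2_fan P2_divisor) \<ge>
        int (code_length 2 K) - fact 2 * int (card (lattice_points 2 P2_fan P2_divisor))"
    unfolding joyner_conjecture_def
    using complete_fan_P2 nonsingular_fan_P2 strictly_convex_P2 by blast
  \<comment> \<open>Such a prime lies both in the range of the supposed bound and in that of the
    counterexample.\<close>
  obtain p :: nat where p: "prime p" "p > max q0 8" using bigger_prime by blast
  interpret residues_prime p "residue_ring (int p)"
    using p(1) by (simp add: residues_prime_def)
  have K: "field (residue_ring (int p))" "finite (carrier (residue_ring (int p)))"
    "card (carrier (residue_ring (int p))) = p"
    by (rule is_field, rule finite, simp add: res_carrier_eq)
  then show False
    using q0[OF _ K] P2_code_bounds[OF K] p(2) by simp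
qed

theorem mainTheorem4:
  shows "complete_fan 2 P2_fan \<and> nonsingular_fan 2 P2_fan \<and> ray_gens 2 P2_fan = P2_rays \<and>
    polytope 2 P2_fan P2_divisor = unit_triangle \<and>
    card (lattice_points 2 P2_fan P2_divisor) = 3 \<and>
    strictly_convex 2 P2_fan (psi 2 P2_fan P2_divisor) \<and>
    self_intersection 2 P2_fan P2_divisor = 1 \<and>
    (\<forall>(q :: nat) (K :: 'a ring).
       field K \<and> finite (carrier K) \<and> card (carrier K) = q \<and> q \<ge> 8 \<longrightarrow>
         int (code_length 2 K) = (int q - 1)\<^sup>2 \<and>
         cycle_degree (eval_cycle 2 K) = (int q - 1)\<^sup>2 \<and>
         cycle_degree (eval_cycle 2 K) > self_intersection 2 P2_fan P2_divisor \<and>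
         int (min_distance 2 K P2_fan P2_divisor) = (int q - 1)\<^sup>2 - (int q - 1) \<and>
         int (min_distance 2 K P2_fan P2_divisor) <
           int (code_length 2 K) - fact 2 * int (card (lattice_points 2 P2_fan P2_divisor)) \<and>
         int (code_length 2 K) - fact 2 * int (card (lattice_points 2 P2_fan P2_divisor)) =
           (int q - 1)\<^sup>2 - 6) \<and>
    \<not> joyner_conjecture"
  using complete_fan_P2 nonsingular_fan_P2 ray_gens_P2 polytope_P2 card_lattice_points_P2
    strictly_convex_P2 self_intersection_P2 P2_code_parameters P2_code_bounds not_joyner_conjecture
  by (intro conjI allI impI; (elim conjE)?) blast+

end
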